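(* Let $G$ be a connected graph with at least one edge, let $\boldsymbol{x}=(x_v)_{v\in V(G)}$ be its positive unit Perron vector, and put $\pi_v:=x_v^2$ for every $v\in V(G)$. Then for every integer $\ell\ge1$, $$\lambda(G)^{\ell}\ \le\ \Phi_G(\pi)\cdot w_\ell(G),\qquad\text{where}\qquad \Phi_G(\pi):=2\sum_{uv\in E(G)}\pi_u\pi_v.$$
   Context: All graphs are finite and simple. $\lambda(G)$ is the spectral radius of the adjacency matrix $A(G)$. The positive unit Perron vector is the eigenvector of $A(G)$ for the eigenvalue $\lambda(G)$ with positive entries and Euclidean norm $1$. $w_\ell(G)$ is the number of walks on $\ell$ vertices in $G$, i.e. sequences $(v_1,\dots,v_\ell)$ of not necessarily distinct vertices with $v_iv_{i+1}\in E(G)$ for $1\le i\le\ell-1$. The sum over $uv\in E(G)$ runs over unordered edges. *)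

theory Defs
  imports
    "Graph_Theory.Digraph_Component"
    "Graph_Theory.Vertex_Walk"
    "Jordan_Normal_Form.Spectral_Radius"
    "HOL-Analysis.L2_Norm"
begin

text \<open>
  A finite simple graph is a digraph in the locale \<^locale>\<open>graph\<close>: finite, symmetric, without
  loops and without parallel arcs. Each edge \<open>uv\<close> is thus represented by the two arcs from \<open>u\<close> to
  \<open>v\<close> and from \<open>v\<close> to \<open>u\<close>; the set \<open>edges G\<close> identifies them again.
\<close>

definition edges :: "('a, 'b) pre_digraph \<Rightarrow> 'a set set" where
  "edges G = {{u, v} | u v. u \<rightarrow>\<^bsub>G\<^esub> v}"

text \<open>
  Matrices are indexed by natural numbers, so the adjacency matrix refers to an enumeration of the
  vertices. The spectral radius does not depend on it.
\<close>

definition vertex_enum :: "('a, 'b) pre_digraph \<Rightarrow> 'a list \<Rightarrow> bool" where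
  "vertex_enum G vs \<longleftrightarrow> distinct vs \<and> set vs = verts G"

definition adjacency_matrix :: "('a, 'b) pre_digraph \<Rightarrow> 'a list \<Rightarrow> 'c :: zero_neq_one mat" where
  "adjacency_matrix G vs =
     mat (length vs) (length vs) (\<lambda>(i, j). if vs ! i \<rightarrow>\<^bsub>G\<^esub> vs ! j then 1 else 0)"

definition graph_radius :: "('a, 'b) pre_digraph \<Rightarrow> 'a list \<Rightarrow> real" where
  "graph_radius G vs = spectral_radius (adjacency_matrix G vs)"

definition perron_vector :: "('a, 'b) pre_digraph \<Rightarrow> 'a list \<Rightarrow> ('a \<Rightarrow> real) \<Rightarrow> bool" where
  "perron_vector G vs x \<longleftrightarrow>
     eigenvector (adjacency_matrix G vs) (vec (length vs) (\<lambda>i. x (vs ! i))) (graph_radius G vs) \<and>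
     (\<forall>v \<in> verts G. 0 < x v) \<and>
     L2_set x (verts G) = 1"

text \<open>The parameter \<open>l\<close> counts vertices, not edges, of the walk.\<close>

definition num_walks :: "('a, 'b) pre_digraph \<Rightarrow> nat \<Rightarrow> nat" where
  "num_walks G l = card {p. vwalk p G \<and> length p = l}"

definition edge_form :: "('a, 'b) pre_digraph \<Rightarrow> ('a \<Rightarrow> real) \<Rightarrow> real" where
  "edge_form G p = 2 * (\<Sum>e \<in> edges G. \<Prod>v \<in> e. p v)"

end

theory Submission
  imports Defs
begin

text \<open>
  Write \<open>\<lambda>\<close> for the spectral radius, \<open>c = (\<Sum>v. x\<^sub>v\<^sup>2 ln x\<^sub>v)\<close>, and give a walk \<open>p\<close> from \<open>u\<close> to \<open>v\<close> the
  weight \<open>x\<^sub>u x\<^sub>v\<close>. The eigenvalue equation, applied once per step, shows that the walks with \<open>k\<close>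
  edges have total weight \<open>\<lambda>\<^sup>k\<close> and that, after division by \<open>\<lambda>\<^sup>k\<close>, the first vertex is distributed
  according to \<open>\<pi>\<close> (\<open>sum_walks_eigenfunction\<close>); reversing walks gives the same for the last vertex.
  The normalised weights are the path probabilities of the stationary Markov chain of maximal
  entropy, and \<open>- 2 c\<close> is the entropy of \<open>\<pi>\<close>.

  Under this distribution \<open>ln x\<^sub>u + ln x\<^sub>v\<close> has mean \<open>2 c\<close>, so Jensen's inequality for \<open>exp\<close> bounds the
  weighted sum of \<open>(x\<^sub>u x\<^sub>v) powr s\<close> from below by \<open>\<lambda>\<^sup>k exp (2 s c)\<close>, for every real \<open>s\<close>
  (\<open>sum_walks_exp_ge\<close>). Two instances are what is needed. On walks with \<open>l\<close> vertices,
  \<open>s = - 1\<close> cancels the weight and gives \<open>w\<^sub>l \<ge> \<lambda>\<^sup>l\<^sup>-\<^sup>1 exp (- 2 c)\<close>. On walks with two vertices, which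
  are the oriented edges, \<open>s = 1\<close> squares the weight and gives \<open>\<Phi> \<ge> \<lambda> exp (2 c)\<close>. In the product
  of the two bounds the exponentials cancel.
\<close>

definition walks :: "('a, 'b) pre_digraph \<Rightarrow> nat \<Rightarrow> 'a list set" where
  "walks G l = {p. vwalk p G \<and> length p = l}"

lemma walks_nonempty_list: "p \<in> walks G l \<Longrightarrow> p \<noteq> []"
  by (auto simp: walks_def vwalk_def)

lemma hd_last_walk_in_verts:
  assumes "p \<in> walks G l"
  shows "hd p \<in> verts G" "last p \<in> verts G"
  using assms by (auto simp: walks_def vwalk_def)

lemma walks_one: "walks G (Suc 0) = (\<lambda>v. [v]) ` verts G"
  by (auto simp: walks_def vwalk_def length_Suc_conv)

context wf_digraph
begin

lemma walks_Suc:
  "walks G (Suc (Suc k)) =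
     (\<lambda>(p, u). u # p) ` (SIGMA p : walks G (Suc k). {u \<in> verts G. u \<rightarrow>\<^bsub>G\<^esub> hd p})"
  by (auto simp: walks_def vwalk_def length_Suc_conv image_iff)

lemma walks_two: "walks G 2 = (\<lambda>(u, v). [u, v]) ` arcs_ends G"
  by (auto simp: walks_def vwalk_def length_Suc_conv numeral_2_eq_2 dest: adj_in_verts
      intro!: image_eqI[where x = "(_, _)"])

end

lemma (in fin_digraph) finite_walks: "finite (walks G l)"
  by (rule finite_subset[OF _ finite_lists_length_eq[OF finite_verts, of l]])
    (auto simp: walks_def vwalk_def)

lemma (in sym_digraph) bij_betw_rev_walks: "bij_betw rev (walks G l) (walks G l)"
proof -
  have "(a, b) \<in> arcs_ends G \<longleftrightarrow> (b, a) \<in> arcs_ends G" for a b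
    using graph_symmetric by blast
  then have "rev p \<in> walks G l" if "p \<in> walks G l" for p
    using that unfolding walks_def vwalk_def by (auto simp: set_vwalk_arcs_rev)
  then show ?thesis
    by (intro bij_betwI[where g = rev]) auto
qed

text \<open>
  The weight \<open>f\<close> on the first vertex is arbitrary so that the induction goes through: removing the
  first vertex of the walk turns \<open>f\<close> into the sum of \<open>f\<close> over the neighbours.
\<close>

lemma (in fin_digraph) sum_walks_eigenfunction:
  fixes x f :: "'a \<Rightarrow> real"
  assumes eig: "\<And>v. v \<in> verts G \<Longrightarrow> (\<Sum>u | u \<in> verts G \<and> v \<rightarrow>\<^bsub>G\<^esub> u. x u) = lam * x v"
  shows "(\<Sum>p\<in>walks G (Suc k). f (hd p) * x (last p)) = lam ^ k * (\<Sum>v\<in>verts G. f v * x v)"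
proof (induction k arbitrary: f)
  case 0
  show ?case by (simp add: walks_one sum.reindex inj_on_def)
next
  case (Suc k)
  let ?N = "\<lambda>v. {u \<in> verts G. u \<rightarrow>\<^bsub>G\<^esub> v}"
  have "(\<Sum>p\<in>walks G (Suc (Suc k)). f (hd p) * x (last p)) =
      (\<Sum>(p, u)\<in>(SIGMA p : walks G (Suc k). ?N (hd p)). f u * x (last p))"
    unfolding walks_Suc
    by (subst sum.reindex) (auto simp: inj_on_def walks_nonempty_list intro!: sum.cong)
  also have "\<dots> = (\<Sum>p\<in>walks G (Suc k). (\<Sum>u\<in>?N (hd p). f u) * x (last p))"
    by (simp add: sum.Sigma[symmetric] finite_walks sum_distrib_right)
  also have "\<dots> = lam ^ k * (\<Sum>v\<in>verts G. (\<Sum>u\<in>?N v. f u) * x v)"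
    by (rule Suc.IH)
  also have "(\<Sum>v\<in>verts G. (\<Sum>u\<in>?N v. f u) * x v) =
      (\<Sum>u\<in>verts G. f u * (\<Sum>v | v \<in> verts G \<and> u \<rightarrow>\<^bsub>G\<^esub> v. x v))"
    unfolding sum_distrib_left sum_distrib_right
    by (rule sum.swap_restrict) simp_all
  also have "\<dots> = lam * (\<Sum>u\<in>verts G. f u * x u)"
    by (simp add: eig sum_distrib_left mult_ac)
  finally show ?case by simp
qed

text \<open>
  Jensen's inequality for \<open>exp\<close>, in the form of its tangent line at the mean \<open>2 s c\<close>; working with
  the tangent line avoids normalising the weights by \<open>\<lambda>\<^sup>k\<close>.
\<close>

lemma (in graph) sum_walks_exp_ge:
  fixes x :: "'a \<Rightarrow> real" and s :: real
  assumes pos: "\<And>v. v \<in> verts G \<Longrightarrow> 0 < x v"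
    and eig: "\<And>v. v \<in> verts G \<Longrightarrow> (\<Sum>u | u \<in> verts G \<and> v \<rightarrow>\<^bsub>G\<^esub> u. x u) = lam * x v"
    and unit: "(\<Sum>v\<in>verts G. (x v)\<^sup>2) = 1"
  defines "c \<equiv> \<Sum>v\<in>verts G. (x v)\<^sup>2 * ln (x v)"
  shows "lam ^ k * exp (2 * s * c) \<le>
    (\<Sum>p\<in>walks G (Suc k). x (hd p) * x (last p) * exp (s * (ln (x (hd p)) + ln (x (last p)))))"
proof -
  let ?W = "walks G (Suc k)"
  let ?w = "\<lambda>p. x (hd p) * x (last p)"
  have mass: "(\<Sum>p\<in>?W. ?w p) = lam ^ k"
    using sum_walks_eigenfunction[OF eig, where f = x] unit by (simp add: power2_eq_square)
  have first: "(\<Sum>p\<in>?W. ?w p * ln (x (hd p))) = lam ^ k * c"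
    using sum_walks_eigenfunction[OF eig, where f = "\<lambda>v. x v * ln (x v)"]
    by (simp add: c_def power2_eq_square mult_ac)
  have "(\<Sum>p\<in>?W. ?w p * ln (x (last p))) = (\<Sum>p\<in>?W. ?w (rev p) * ln (x (last (rev p))))"
    by (rule sum.reindex_bij_betw[OF bij_betw_rev_walks, symmetric])
  also have "\<dots> = lam ^ k * c"
    unfolding first[symmetric] by (simp add: hd_rev last_rev mult_ac)
  finally have final: "(\<Sum>p\<in>?W. ?w p * ln (x (last p))) = lam ^ k * c" .
  let ?t = "\<lambda>p. s * (ln (x (hd p)) + ln (x (last p))) - 2 * s * c"
  have "(\<Sum>p\<in>?W. ?w p * (1 + ?t p)) =
      (1 - 2 * s * c) * (\<Sum>p\<in>?W. ?w p) + s * (\<Sum>p\<in>?W. ?w p * ln (x (hd p)))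
      + s * (\<Sum>p\<in>?W. ?w p * ln (x (last p)))"
    unfolding sum_distrib_left sum.distrib[symmetric]
    by (rule sum.cong) (auto simp: algebra_simps)
  also have "\<dots> = lam ^ k"
    unfolding mass first final by (simp add: algebra_simps)
  finally have "lam ^ k = (\<Sum>p\<in>?W. ?w p * (1 + ?t p))" ..
  also have "\<dots> \<le> (\<Sum>p\<in>?W. ?w p * exp (?t p))"
    by (intro sum_mono mult_left_mono exp_ge_add_one_self)
      (simp add: pos hd_last_walk_in_verts less_imp_le)
  finally have "lam ^ k * exp (2 * s * c) \<le> (\<Sum>p\<in>?W. ?w p * exp (?t p)) * exp (2 * s * c)"
    by (rule mult_right_mono) simp
  also have "\<dots> = (\<Sum>p\<in>?W. ?w p * exp (s * (ln (x (hd p)) + ln (x (last p)))))"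
    unfolding sum_distrib_right mult.assoc exp_add[symmetric] by simp
  finally show ?thesis .
qed

text \<open>Each edge is traversed by exactly two walks on two vertices, which accounts for the factor 2.\<close>

lemma (in graph) edge_form_eq_sum_walks:
  "edge_form G q = (\<Sum>p\<in>walks G 2. q (hd p) * q (last p))"
proof -
  have edges: "edges G = set ` walks G 2"
    unfolding walks_two edges_def by (force simp: image_iff)
  have "(\<Sum>p\<in>walks G 2. q (hd p) * q (last p)) =
      (\<Sum>e\<in>edges G. \<Sum>p | p \<in> walks G 2 \<and> set p = e. q (hd p) * q (last p))"
    unfolding edges by (rule sum.image_gen) (rule finite_walks)
  also have "\<dots> = (\<Sum>e\<in>edges G. 2 * (\<Prod>v\<in>e. q v))"
  proof (rule sum.cong[OF refl])
    fix e assume "e \<in> edges G"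
    then obtain u v where uv: "u \<rightarrow>\<^bsub>G\<^esub> v" and e: "e = {u, v}"
      by (auto simp: edges_def)
    have "u \<noteq> v" using uv adj_not_same by blast
    have "v \<rightarrow>\<^bsub>G\<^esub> u" using uv by (rule graph_symmetric)
    then have "[u, v] \<in> walks G 2" "[v, u] \<in> walks G 2"
      using uv unfolding walks_two by (auto intro: rev_image_eqI)
    moreover have "p = [u, v] \<or> p = [v, u]" if "p \<in> walks G 2" "set p = e" for p
    proof -
      obtain a b where p: "p = [a, b]"
        using \<open>p \<in> walks G 2\<close> unfolding walks_two by auto
      then have "{a, b} = {u, v}"
        using \<open>set p = e\<close> e by simp
      then show ?thesis
        unfolding p doubleton_eq_iff by blast
    qed
    moreover have "set [u, v] = e" "set [v, u] = e"
      unfolding e by auto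
    ultimately have fibre: "{p. p \<in> walks G 2 \<and> set p = e} = {[u, v], [v, u]}"
      by blast
    show "(\<Sum>p | p \<in> walks G 2 \<and> set p = e. q (hd p) * q (last p)) = 2 * (\<Prod>v\<in>e. q v)"
      unfolding fibre using \<open>u \<noteq> v\<close> by (simp add: e)
  qed
  finally show ?thesis by (simp add: edge_form_def sum_distrib_left)
qed

lemma perron_vector_eigenvalue_equation:
  assumes "vertex_enum G vs" "perron_vector G vs x" "v \<in> verts G"
  shows "(\<Sum>u | u \<in> verts G \<and> v \<rightarrow>\<^bsub>G\<^esub> u. x u) = graph_radius G vs * x v"
proof -
  let ?n = "length vs" and ?A = "adjacency_matrix G vs :: real mat"
  have vs: "distinct vs" "set vs = verts G"
    using assms(1) by (auto simp: vertex_enum_def)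
  obtain i where i: "i < ?n" "vs ! i = v"
    using assms(3) vs by (metis in_set_conv_nth)
  have bij: "bij_betw ((!) vs) {0..<?n} (verts G)"
    using vs by (auto intro!: bij_betw_nth)
  have "?A *\<^sub>v vec ?n (\<lambda>i. x (vs ! i)) = graph_radius G vs \<cdot>\<^sub>v vec ?n (\<lambda>i. x (vs ! i))"
    using assms(2) unfolding perron_vector_def eigenvector_def by blast
  then have "(?A *\<^sub>v vec ?n (\<lambda>i. x (vs ! i))) $ i = graph_radius G vs * x v"
    using i by simp
  moreover have "(?A *\<^sub>v vec ?n (\<lambda>i. x (vs ! i))) $ i =
      (\<Sum>j\<in>{0..<?n}. if v \<rightarrow>\<^bsub>G\<^esub> vs ! j then x (vs ! j) else 0)"
    using i by (auto simp: adjacency_matrix_def scalar_prod_def intro!: sum.cong)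
  moreover have "\<dots> = (\<Sum>u\<in>verts G. if v \<rightarrow>\<^bsub>G\<^esub> u then x u else 0)"
    by (rule sum.reindex_bij_betw[OF bij])
  moreover have "\<dots> = (\<Sum>u | u \<in> verts G \<and> v \<rightarrow>\<^bsub>G\<^esub> u. x u)"
    using vs by (metis (no_types) List.finite_set sum.inter_filter)
  ultimately show ?thesis by simp
qed

theorem theorem1p6:
  fixes G :: "('a, 'b) pre_digraph" and vs :: "'a list"
    and x \<pi> :: "'a \<Rightarrow> real" and l :: nat
  assumes "graph G" and "connected G" and "edges G \<noteq> {}"
    and "vertex_enum G vs"
    and "perron_vector G vs x"
    and "\<And>v. v \<in> verts G \<Longrightarrow> \<pi> v = (x v)\<^sup>2"
    and "l \<ge> 1"
  shows "graph_radius G vs ^ l \<le> edge_form G \<pi> * real (num_walks G l)"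
proof -
  interpret graph G by fact
  define lam where "lam = graph_radius G vs"
  define c where "c = (\<Sum>v\<in>verts G. (x v)\<^sup>2 * ln (x v))"
  obtain k where l: "l = Suc k"
    using assms(7) by (cases l) auto
  have pos: "0 < x v" if "v \<in> verts G" for v
    using assms(5) that by (simp add: perron_vector_def)
  have unit: "(\<Sum>v\<in>verts G. (x v)\<^sup>2) = 1"
    using assms(5) by (simp add: perron_vector_def L2_set_def)
  have eig: "(\<Sum>u | u \<in> verts G \<and> v \<rightarrow>\<^bsub>G\<^esub> u. x u) = lam * x v" if "v \<in> verts G" for v
    unfolding lam_def using assms(4,5) that by (rule perron_vector_eigenvalue_equation)
  note bound = sum_walks_exp_ge[where x = x and lam = lam, OF pos eig unit, folded c_def]
  obtain v where v: "v \<in> verts G"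
    using unit by fastforce
  have "0 \<le> lam * x v"
    unfolding eig[OF v, symmetric] by (rule sum_nonneg) (auto intro: less_imp_le pos)
  then have lam: "0 \<le> lam"
    using pos[OF v] by (simp add: zero_le_mult_iff)

  have "lam * exp (2 * c) \<le>
      (\<Sum>p\<in>walks G 2. x (hd p) * x (last p) * exp (ln (x (hd p)) + ln (x (last p))))"
    using bound[where k = 1 and s = 1] by (simp add: numeral_2_eq_2)
  also have "\<dots> = (\<Sum>p\<in>walks G 2. \<pi> (hd p) * \<pi> (last p))"
    by (rule sum.cong)
      (simp_all add: assms(6) pos hd_last_walk_in_verts exp_add power2_eq_square mult_ac)
  also have "\<dots> = edge_form G \<pi>"
    by (rule edge_form_eq_sum_walks[symmetric])
  finally have edge_bound: "lam * exp (2 * c) \<le> edge_form G \<pi>" .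

  have "lam ^ k * exp (- 2 * c) \<le> (\<Sum>p\<in>walks G l.
      x (hd p) * x (last p) * exp (- (ln (x (hd p)) + ln (x (last p)))))"
    using bound[where k = k and s = "- 1"] by (simp add: l)
  also have "\<dots> = (\<Sum>p\<in>walks G l. 1)"
  proof (rule sum.cong[OF refl])
    fix p assume p: "p \<in> walks G l"
    show "x (hd p) * x (last p) * exp (- (ln (x (hd p)) + ln (x (last p)))) = 1"
      using pos[OF hd_last_walk_in_verts(1)[OF p]] pos[OF hd_last_walk_in_verts(2)[OF p]]
      by (simp add: exp_diff exp_minus field_simps)
  qed
  also have "\<dots> = real (num_walks G l)"
    by (simp add: num_walks_def walks_def)
  finally have walk_bound: "lam ^ k * exp (- 2 * c) \<le> real (num_walks G l)" .

  have "lam ^ l = (lam * exp (2 * c)) * (lam ^ k * exp (- 2 * c))"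
    by (simp add: l exp_minus)
  also have "\<dots> \<le> edge_form G \<pi> * real (num_walks G l)"
    using edge_bound walk_bound lam
    by (intro mult_mono) (auto intro: order_trans[rotated])
  finally show ?thesis by (simp add: lam_def)
qed

end
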